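(* Let $S$ be a finite left regular band with identity, $L$ its support lattice, and $k$ an arbitrary field. For each $X\in L$ fix $x\in S$ with $\operatorname{supp}(x)=X$, and define elements of $kS$ recursively (from the top of $L$ downward) by $e_X=x-\sum_{Y>X}xe_Y$. Then $\{e_X\}_{X\in L}$ is a complete system of primitive orthogonal idempotents in $kS$.
   Context: A left regular band is a semigroup $S$ with $x^2=x$ and $xyx=xy$ for all $x,y\in S$. Define the preorder $y\preceq x$ iff $xy=x$; identifying $x,y$ when $x\preceq y\preceq x$ gives a poset $L$ (a finite lattice when $S$ is finite with identity), the support lattice, with quotient map $\operatorname{supp}:S\to L$ satisfying $\operatorname{supp}(xy)=\operatorname{supp}(x)\vee\operatorname{supp}(y)$ and $xy=x$ iff $\operatorname{supp}(y)\le\operatorname{supp}(x)$. A complete system of primitive orthogonal idempotents is a family of primitive idempotents $e_i$ with $e_ie_j=0$ for $i\ne j$ and $\sum_ie_i=1$; an idempotent is primitive if it is not a sum of two nonzero orthogonal idempotents. *)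

theory Defs
  imports "HOL-Library.Poly_Mapping"
begin

section \<open>Left regular bands and their support lattices\<close>

class left_regular_band = semigroup_mult +
  assumes mult_idem: "x * x = x"
    and mult_left_regular: "x * y * x = x * y"

class left_regular_band_1 = left_regular_band + monoid_mult

definition lrb_le :: "'s::left_regular_band \<Rightarrow> 's \<Rightarrow> bool"  (infix \<open>\<preceq>\<close> 50)
  where "y \<preceq> x \<longleftrightarrow> x * y = x"

lemma lrb_le_refl: "x \<preceq> x"
  by (simp add: lrb_le_def mult_idem)

lemma lrb_le_trans: "x \<preceq> y \<Longrightarrow> y \<preceq> z \<Longrightarrow> x \<preceq> z"
  unfolding lrb_le_def by (metis mult.assoc)

definition lrb_equiv :: "'s::left_regular_band \<Rightarrow> 's \<Rightarrow> bool"
  where "lrb_equiv x y \<longleftrightarrow> x \<preceq> y \<and> y \<preceq> x"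

quotient_type (overloaded) 's support = "'s::left_regular_band" / lrb_equiv
  morphisms rep_support supp
  by (rule equivpI)
    (auto simp: reflp_def symp_def transp_def lrb_equiv_def intro: lrb_le_refl lrb_le_trans)

lemma lrb_le_mult_left: "x \<preceq> x * y"
  by (simp add: lrb_le_def mult_left_regular)

lemma lrb_le_mult_right: "y \<preceq> x * y"
  by (simp add: lrb_le_def mult.assoc mult_idem)

lemma lrb_mult_le: "x \<preceq> z \<Longrightarrow> y \<preceq> z \<Longrightarrow> x * y \<preceq> z"
  unfolding lrb_le_def by (metis mult.assoc)

instantiation support :: (left_regular_band) semilattice_sup
begin

lift_definition less_eq_support :: "'a support \<Rightarrow> 'a support \<Rightarrow> bool" is "(\<preceq>)"
  by (auto simp: lrb_equiv_def intro: lrb_le_trans)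

definition less_support :: "'a support \<Rightarrow> 'a support \<Rightarrow> bool"
  where "less_support X Y \<longleftrightarrow> X \<le> Y \<and> \<not> Y \<le> X"

lift_definition sup_support :: "'a support \<Rightarrow> 'a support \<Rightarrow> 'a support" is "(*)"
  unfolding lrb_equiv_def
  by (meson lrb_mult_le lrb_le_mult_left lrb_le_mult_right lrb_le_trans)

instance
proof
  fix X Y Z :: "'a support"
  show "X < Y \<longleftrightarrow> X \<le> Y \<and> \<not> Y \<le> X" by (rule less_support_def)
  show "X \<le> X" by transfer (rule lrb_le_refl)
  show "X \<le> Y \<Longrightarrow> Y \<le> Z \<Longrightarrow> X \<le> Z" by transfer (rule lrb_le_trans)
  show "X \<le> Y \<Longrightarrow> Y \<le> X \<Longrightarrow> X = Y" by transfer (simp add: lrb_equiv_def)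
  show "X \<le> sup X Y" by transfer (rule lrb_le_mult_left)
  show "Y \<le> sup X Y" by transfer (rule lrb_le_mult_right)
  show "Y \<le> X \<Longrightarrow> Z \<le> X \<Longrightarrow> sup Y Z \<le> X" by transfer (rule lrb_mult_le)
qed

end

lemma supp_le_iff: "supp y \<le> supp x \<longleftrightarrow> x * y = x"
  by (simp add: less_eq_support.abs_eq lrb_le_def)

lemma supp_mult: "supp (x * y) = sup (supp x) (supp y)"
  by (simp add: sup_support.abs_eq)

instantiation support :: (left_regular_band_1) order_bot
begin

lift_definition bot_support :: "'a support" is 1 .

instance
  by standard (transfer, simp add: lrb_le_def)

end

instance support :: ("{left_regular_band, finite}") finite
proof
  have "(UNIV :: 'a support set) = range supp"
    by (metis UNIV_eq_I Quotient_support Quotient_abs_rep rangeI)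
  then show "finite (UNIV :: 'a support set)"
    by (metis finite_imageI finite)
qed

instantiation support :: ("{left_regular_band_1, finite}") lattice
begin

definition inf_support :: "'a support \<Rightarrow> 'a support \<Rightarrow> 'a support"
  where "inf_support X Y = Sup_fin {Z. Z \<le> X \<and> Z \<le> Y}"

instance
proof
  fix X Y Z :: "'a support"
  have ne: "{Z. Z \<le> X \<and> Z \<le> Y} \<noteq> {}"
    using bot_least by blast
  show "inf X Y \<le> X"
    unfolding inf_support_def by (rule Sup_fin.boundedI) (use ne in auto)
  show "inf X Y \<le> Y"
    unfolding inf_support_def by (rule Sup_fin.boundedI) (use ne in auto)
  show "X \<le> Y \<Longrightarrow> X \<le> Z \<Longrightarrow> X \<le> inf Y Z"
    unfolding inf_support_def by (rule Sup_fin.coboundedI) auto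
qed

end


section \<open>The monoid algebra\<close>

text \<open>
  The multiplication of \<^typ>\<open>'a \<Rightarrow>\<^sub>0 'b\<close> is convolution with respect to an additively written,
  not necessarily commutative, monoid of exponents. The type below is a copy of a multiplicative
  monoid in additive notation, so that its finitely supported functions are the monoid algebra.
\<close>

datatype 's exponent = Exponent 's

instantiation exponent :: (monoid_mult) monoid_add
begin

definition zero_exponent :: "'a exponent"
  where "0 = Exponent 1"

fun plus_exponent :: "'a exponent \<Rightarrow> 'a exponent \<Rightarrow> 'a exponent"
  where "Exponent x + Exponent y = Exponent (x * y)"

instance
proof
  fix a b c :: "'a exponent"
  show "a + b + c = a + (b + c)" by (cases a; cases b; cases c) (simp add: mult.assoc)
  show "0 + a = a" by (cases a) (simp add: zero_exponent_def)
  show "a + 0 = a" by (cases a) (simp add: zero_exponent_def)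
qed

end

type_synonym ('s, 'k) monoid_algebra = "'s exponent \<Rightarrow>\<^sub>0 'k"

definition basis_elem :: "'s \<Rightarrow> ('s, 'k::zero_neq_one) monoid_algebra"
  where "basis_elem x = Poly_Mapping.single (Exponent x) 1"

lemma basis_elem_mult:
  "basis_elem x * basis_elem y = (basis_elem (x * y) :: ('s::monoid_mult, 'k::ring_1) monoid_algebra)"
  by (simp add: basis_elem_def mult_single)

lemma basis_elem_one: "basis_elem 1 = (1 :: ('s::monoid_mult, 'k::ring_1) monoid_algebra)"
  unfolding basis_elem_def zero_exponent_def[symmetric] by (rule single_one)


section \<open>Idempotents\<close>

definition idempotent :: "'a::ring_1 \<Rightarrow> bool"
  where "idempotent a \<longleftrightarrow> a * a = a"

text \<open>By the usual convention, \<open>0\<close> is not primitive.\<close>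

definition primitive_idempotent :: "'a::ring_1 \<Rightarrow> bool"
  where "primitive_idempotent a \<longleftrightarrow>
    idempotent a \<and> a \<noteq> 0 \<and>
    \<not> (\<exists>f g. idempotent f \<and> idempotent g \<and> f \<noteq> 0 \<and> g \<noteq> 0 \<and> f * g = 0 \<and> g * f = 0 \<and> a = f + g)"

definition complete_primitive_orthogonal_idempotents :: "'i set \<Rightarrow> ('i \<Rightarrow> 'a::ring_1) \<Rightarrow> bool"
  where "complete_primitive_orthogonal_idempotents I e \<longleftrightarrow>
    finite I \<and>
    (\<forall>i\<in>I. primitive_idempotent (e i)) \<and>
    (\<forall>i\<in>I. \<forall>j\<in>I. i \<noteq> j \<longrightarrow> e i * e j = 0) \<and>
    (\<Sum>i\<in>I. e i) = 1"

function lrb_idem ::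
  "('s support \<Rightarrow> 's::{left_regular_band_1, finite}) \<Rightarrow> 's support \<Rightarrow> ('s, 'k::field) monoid_algebra"
  where "lrb_idem r X = basis_elem (r X) - (\<Sum>Y\<in>{Y. Y > X}. basis_elem (r X) * lrb_idem r Y)"
  by pat_completeness auto

termination
  by (relation "measure (\<lambda>(r, X). card {Y. Y > X})") (auto intro!: psubset_card_mono)

declare lrb_idem.simps [simp del]

end

theory Submission
  imports Defs
begin

text \<open>
  Write \<open>e\<^sub>X\<close> for \<open>lrb_idem r X\<close>. The key point is that \<open>w e\<^sub>X = 0\<close> unless \<open>supp w \<le> X\<close>: with
  \<open>Z = sup (supp w) X\<close>, downward induction on \<open>X\<close> removes from the recursion for \<open>w e\<^sub>X\<close> all terms
  except those with \<open>Y \<ge> Z\<close>, and what remains is \<open>w x (e\<^sub>Z - z e\<^sub>Z) = 0\<close>, where \<open>x\<close> and \<open>z\<close> are the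
  chosen representatives of \<open>X\<close> and \<open>Z\<close>. Orthogonality follows from the recursion. Dually,
  \<open>e\<^sub>X w = e\<^sub>X\<close> if \<open>supp w \<le> X\<close>. Together these show that \<open>e\<^sub>X (kS) e\<^sub>X\<close> is the line \<open>k e\<^sub>X\<close>, so
  \<open>e\<^sub>X\<close> is primitive.
\<close>

text \<open>In an orthogonal decomposition \<open>e = f + g\<close> the summand \<open>f\<close>
  satisfies \<open>e * f * e = f\<close>, so it is enough to know the idempotents in the corner ring
  of \<open>e\<close>.\<close>

lemma primitive_idempotentI:
  fixes e :: "'a::ring_1"
  assumes "idempotent e" "e \<noteq> 0"
    and corner: "\<And>f. idempotent f \<Longrightarrow> e * f * e = f \<Longrightarrow> f = 0 \<or> f = e"
  shows "primitive_idempotent e"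
  unfolding primitive_idempotent_def
proof (intro conjI notI)
  assume "\<exists>f g. idempotent f \<and> idempotent g \<and> f \<noteq> 0 \<and> g \<noteq> 0 \<and> f * g = 0 \<and> g * f = 0 \<and> e = f + g"
  then obtain f g where fg: "idempotent f" "f \<noteq> 0" "g \<noteq> 0" "f * g = 0" "g * f = 0" "e = f + g"
    by blast
  then have "e * f * e = f"
    by (simp add: idempotent_def algebra_simps)
  with corner fg show False
    by fastforce
qed (use assms in auto)

lemma poly_mapping_single_plus_induct [case_names single sum]:
  fixes a :: "'a \<Rightarrow>\<^sub>0 'b::monoid_add"
  assumes single: "\<And>k v. P (Poly_Mapping.single k v)"
    and sum: "\<And>f g. P f \<Longrightarrow> P g \<Longrightarrow> P (f + g)"
  shows "P a"
proof (induction a rule: Poly_Mapping.update_induct)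
  case const
  show ?case
    using single[of _ 0] by simp
next
  case (update f k v)
  then have "Poly_Mapping.update k v f = Poly_Mapping.single k v + f"
    by (intro poly_mapping_eqI)
      (auto simp: lookup_update lookup_add lookup_single when_def in_keys_iff)
  with update show ?case
    by (simp add: single sum)
qed

text \<open>\<open>Poly_Mapping.single 0 c\<close> serves as the scalar \<open>c\<close>:
  \<open>0\<close> is the neutral exponent and the coefficients commute.\<close>

lemma single_zero_central:
  fixes a :: "'a::monoid_add \<Rightarrow>\<^sub>0 'k::comm_ring_1"
  shows "a * Poly_Mapping.single 0 c = Poly_Mapping.single 0 c * a"
  by (induction a rule: poly_mapping_single_plus_induct) (simp_all add: mult_single algebra_simps)

lemma single_eq_scalar_mult_basis_elem:
  "Poly_Mapping.single (Exponent w) c =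
    Poly_Mapping.single 0 c * (basis_elem w :: ('s::monoid_mult, 'k::ring_1) monoid_algebra)"
  by (simp add: basis_elem_def mult_single)

lemma keys_basis_elem_mult:
  fixes a :: "('s::monoid_mult, 'k::ring_1) monoid_algebra"
  assumes "Exponent v \<in> Poly_Mapping.keys (basis_elem w * a)"
  obtains u where "Exponent u \<in> Poly_Mapping.keys a" "v = w * u"
proof -
  obtain b where b: "b \<in> Poly_Mapping.keys a" "Exponent v = Exponent w + b"
    using assms keys_mult[of "basis_elem w" a] by (auto simp: basis_elem_def)
  then show ?thesis
    by (cases b) (auto intro: that)
qed

lemma support_induct_downward:
  fixes X :: "'s::{left_regular_band, finite} support"
  assumes "\<And>X. (\<And>Y. X < Y \<Longrightarrow> P Y) \<Longrightarrow> P X"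
  shows "P X"
proof (induction "card {Y. X < Y}" arbitrary: X rule: less_induct)
  case less
  show ?case
    by (rule assms, rule less, rule psubset_card_mono) auto
qed

text \<open>Having \<open>e\<close> as a parameter pins down the coefficient field, which
  \<open>r\<close> alone does not determine.\<close>

locale support_section =
  fixes r :: "'s::{left_regular_band_1, finite} support \<Rightarrow> 's"
    and e :: "'s support \<Rightarrow> ('s, 'k::field) monoid_algebra"
  assumes supp_r: "supp (r X) = X"
  defines "e \<equiv> lrb_idem r"
begin

lemma idem_rec: "e X = basis_elem (r X) - (\<Sum>Y\<in>{Y. X < Y}. basis_elem (r X) * e Y)"
  unfolding e_def by (rule lrb_idem.simps)

lemma basis_elem_r_mult_idem: "basis_elem (r X) * e X = e X"
  unfolding idem_rec[of X]
  by (simp add: right_diff_distrib sum_distrib_left mult.assoc[symmetric] basis_elem_mult mult_idem)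

lemma basis_elem_mult_idem_eq_0:
  "\<not> supp w \<le> X \<Longrightarrow> basis_elem w * e X = 0"
proof (induction X arbitrary: w rule: support_induct_downward)
  case (1 X)
  define u where "u = w * r X"
  define Z where "Z = supp u"
  have Z: "Z = sup (supp w) X"
    by (simp add: Z_def u_def supp_mult supp_r)
  with 1(2) have "X < Z"
    by (simp add: less_le_not_le)
  \<comment> \<open>\<open>u\<close> and \<open>r Z\<close> have the same support, so
    \<open>u\<close> absorbs \<open>r Z\<close>; inserting it makes the recursion for
    \<open>e Z\<close> appear to the right of \<open>u\<close>.\<close>
  have uz: "basis_elem u * basis_elem (r Z) = (basis_elem u :: ('s, 'k) monoid_algebra)"
    by (metis Z_def basis_elem_mult order_refl supp_le_iff supp_r)
  have "basis_elem w * e X = basis_elem u - (\<Sum>Y\<in>{Y. X < Y}. basis_elem u * e Y)"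
    unfolding idem_rec[of X]
    by (simp add: right_diff_distrib sum_distrib_left mult.assoc[symmetric] basis_elem_mult u_def)
  also have "(\<Sum>Y\<in>{Y. X < Y}. basis_elem u * e Y) = (\<Sum>Y\<in>{Y. Z \<le> Y}. basis_elem u * e Y)"
    using 1(1) \<open>X < Z\<close> by (intro sum.mono_neutral_right) (auto simp: Z_def)
  also have "{Y. Z \<le> Y} = insert Z {Y. Z < Y}"
    by auto
  also have "basis_elem u - (\<Sum>Y\<in>insert Z {Y. Z < Y}. basis_elem u * e Y) =
    basis_elem u * basis_elem (r Z) - basis_elem u * e Z
      - (\<Sum>Y\<in>{Y. Z < Y}. basis_elem u * basis_elem (r Z) * e Y)"
    by (simp add: uz)
  also have "\<dots> = basis_elem u * (e Z - e Z)"
    by (subst (2) idem_rec) (simp add: right_diff_distrib sum_distrib_left mult.assoc)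
  finally show ?case by simp
qed

text \<open>In the recursion \<open>r X\<close> absorbs \<open>w\<close> on the right, and so does
  each \<open>e Y\<close> with \<open>X < Y\<close>, by downward induction.\<close>

lemma idem_mult_basis_elem:
  "supp w \<le> X \<Longrightarrow> e X * basis_elem w = e X"
proof (induction X rule: support_induct_downward)
  case (1 X)
  have "r X * w = r X"
    using 1(2) by (metis supp_le_iff supp_r)
  moreover have "e Y * basis_elem w = e Y" if "X < Y" for Y
    using 1 that by (meson less_imp_le order_trans)
  ultimately show ?case
    by (subst (1 2) idem_rec) (simp add: left_diff_distrib sum_distrib_right mult.assoc basis_elem_mult)
qed

text \<open>In the recursion for \<open>e Y\<close>, the leading \<open>r Y\<close> annihilates
  \<open>e X\<close>, and the induction applies to the other terms, as no \<open>Z\<close> above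
  \<open>Y\<close> lies below \<open>X\<close>.\<close>

lemma idem_mult_idem_eq_0_if_not_le:
  "\<not> Y \<le> X \<Longrightarrow> e Y * e X = 0"
proof (induction Y rule: support_induct_downward)
  case (1 Y)
  have "e Z * e X = 0" if "Y < Z" for Z
    using 1 that by (meson less_imp_le order_trans)
  then show ?case
    using 1(2) by (subst idem_rec)
      (simp add: left_diff_distrib sum_distrib_right mult.assoc basis_elem_mult_idem_eq_0 supp_r)
qed

lemma idempotent_idem: "e X * e X = e X"
proof -
  have "e X * e X = basis_elem (r X) * e X - (\<Sum>Y\<in>{Y. X < Y}. basis_elem (r X) * (e Y * e X))"
    by (subst (1) idem_rec) (simp add: left_diff_distrib sum_distrib_right mult.assoc)
  then show ?thesis
    by (simp add: basis_elem_r_mult_idem idem_mult_idem_eq_0_if_not_le less_le_not_le)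
qed

lemma orthogonal_idem: "Y \<noteq> X \<Longrightarrow> e Y * e X = 0"
proof (induction Y rule: support_induct_downward)
  case (1 Y)
  show ?case
  proof (cases "Y < X")
    case False
    with 1(2) show ?thesis
      by (simp add: idem_mult_idem_eq_0_if_not_le)
  next
    case True
    have "e Y * e X = basis_elem (r Y) * e X - (\<Sum>Z\<in>{Z. Y < Z}. basis_elem (r Y) * (e Z * e X))"
      by (subst (1) idem_rec) (simp add: left_diff_distrib sum_distrib_right mult.assoc)
    \<comment> \<open>By induction only \<open>Z = X\<close> survives; since \<open>e X\<close> is
      idempotent, this term cancels the leading one.\<close>
    also have "(\<Sum>Z\<in>{Z. Y < Z}. basis_elem (r Y) * (e Z * e X)) =
      (\<Sum>Z\<in>{X}. basis_elem (r Y) * (e Z * e X))"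
      using 1(1) True by (intro sum.mono_neutral_right) auto
    finally show ?thesis
      by (simp add: idempotent_idem)
  qed
qed

lemma sum_idem: "(\<Sum>X\<in>UNIV. e X) = 1"
proof -
  \<comment> \<open>Only \<open>1\<close> has support \<open>bot\<close>, so the recursion at
    \<open>bot\<close> reads: \<open>e bot\<close> is \<open>1\<close> minus the sum of all other
    \<open>e Y\<close>.\<close>
  have r_bot: "r bot = 1"
    by (metis bot_support.abs_eq mult_1_left order_refl supp_le_iff supp_r)
  have "(UNIV :: 's support set) = insert bot {Y. bot < Y}"
    by (auto simp: order.strict_iff_order)
  then have "(\<Sum>X\<in>UNIV. e X) = (\<Sum>X\<in>insert bot {Y. bot < Y}. e X)"
    by (rule arg_cong)
  also have "\<dots> = e bot + (\<Sum>Y\<in>{Y. bot < Y}. e Y)"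
    by (rule sum.insert) auto
  also have "\<dots> = 1"
    by (subst idem_rec) (simp add: r_bot basis_elem_one)
  finally show ?thesis .
qed

text \<open>The coefficient at \<open>r X\<close> is \<open>1\<close>. Since
  \<open>e Y = r Y * e Y\<close>, every element occurring in \<open>r X * e Y\<close> has the form
  \<open>r X * r Y * v\<close>; its support is at least \<open>Y\<close>, so for
  \<open>X < Y\<close> it is not \<open>r X\<close>.\<close>

lemma idem_nonzero: "e X \<noteq> 0"
proof -
  have "Poly_Mapping.lookup (basis_elem (r X) * e Y) (Exponent (r X)) = 0" if "X < Y" for Y
  proof (rule ccontr)
    assume "Poly_Mapping.lookup (basis_elem (r X) * e Y) (Exponent (r X)) \<noteq> 0"
    then obtain u where u: "Exponent u \<in> Poly_Mapping.keys (e Y)" "r X = r X * u"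
      by (metis in_keys_iff keys_basis_elem_mult)
    obtain v where v: "u = r Y * v"
      using u(1) basis_elem_r_mult_idem by (metis keys_basis_elem_mult)
    have "supp (r X) = sup (supp (r X)) (sup (supp (r Y)) (supp v))"
      using u(2) v supp_mult by metis
    then have "Y \<le> X"
      by (metis supp_r le_supI1 sup_ge1 sup_ge2 order_trans)
    with that show False by simp
  qed
  then have "Poly_Mapping.lookup (e X) (Exponent (r X)) = 1"
    by (subst idem_rec) (simp add: lookup_minus lookup_sum basis_elem_def)
  then show ?thesis by auto
qed

text \<open>By additivity in \<open>a\<close> only scalar multiples of monoid elements
  \<open>w\<close> matter, and \<open>e X * w * e X\<close> is \<open>e X\<close> or
  \<open>0\<close> according to whether \<open>supp w \<le> X\<close>.\<close>

lemma corner_idem: "\<exists>c. e X * a * e X = Poly_Mapping.single 0 c * e X"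
proof (induction a rule: poly_mapping_single_plus_induct)
  case (single k c)
  obtain w where k: "k = Exponent w" by (cases k)
  have "e X * Poly_Mapping.single k c * e X = Poly_Mapping.single 0 c * (e X * basis_elem w * e X)"
    unfolding k single_eq_scalar_mult_basis_elem
    by (metis mult.assoc single_zero_central)
  also have "e X * basis_elem w * e X = (if supp w \<le> X then e X else 0)"
  proof (cases "supp w \<le> X")
    case True
    then show ?thesis
      by (simp add: idem_mult_basis_elem idempotent_idem)
  next
    case False
    then show ?thesis
      by (simp add: basis_elem_mult_idem_eq_0 mult.assoc)
  qed
  also have "Poly_Mapping.single 0 c * \<dots> = Poly_Mapping.single 0 (if supp w \<le> X then c else 0) * e X"
    by simp
  finally show ?case ..
next
  case (sum f g)
  then obtain c d where "e X * f * e X = Poly_Mapping.single 0 c * e X"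
    "e X * g * e X = Poly_Mapping.single 0 d * e X"
    by blast
  then have "e X * (f + g) * e X = Poly_Mapping.single 0 (c + d) * e X"
    by (simp add: distrib_left distrib_right single_add)
  then show ?case ..
qed

lemma primitive_idem: "primitive_idempotent (e X)"
proof (rule primitive_idempotentI)
  fix f assume f: "idempotent f" "e X * f * e X = f"
  then obtain c where c: "f = Poly_Mapping.single 0 c * e X"
    using corner_idem by metis
  have "f * f = Poly_Mapping.single 0 c * Poly_Mapping.single 0 c * e X"
    unfolding c by (metis mult.assoc single_zero_central idempotent_idem)
  with f(1) have "Poly_Mapping.single 0 (c * c) * e X = Poly_Mapping.single 0 c * e X"
    by (simp add: idempotent_def c mult_single)
  then have *: "Poly_Mapping.single 0 (c * c - c) * e X = 0"
    by (simp add: single_diff left_diff_distrib)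
  \<comment> \<open>A nonzero scalar is invertible and cannot annihilate the nonzero
    \<open>e X\<close>.\<close>
  have "c * c - c = 0"
  proof (rule ccontr)
    assume "c * c - c \<noteq> 0"
    then have "e X = Poly_Mapping.single 0 (inverse (c * c - c)) * (Poly_Mapping.single 0 (c * c - c) * e X)"
      by (simp add: mult.assoc[symmetric] mult_single)
    with * idem_nonzero show False by simp
  qed
  then have "c = 0 \<or> c = 1"
    by auto
  then show "f = 0 \<or> f = e X"
    by (auto simp: c)
qed (auto simp: idempotent_def idempotent_idem idem_nonzero)

end

theorem theorem4p2:
  fixes r :: "'s::{left_regular_band_1, finite} support \<Rightarrow> 's"
  assumes "\<And>X. supp (r X) = X"
  shows "complete_primitive_orthogonal_idempotents UNIV
    (lrb_idem r :: 's support \<Rightarrow> ('s, 'k::field) monoid_algebra)"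
proof -
  interpret support_section r "lrb_idem r :: 's support \<Rightarrow> ('s, 'k) monoid_algebra"
    by unfold_locales (simp_all add: assms)
  show ?thesis
    by (simp add: complete_primitive_orthogonal_idempotents_def
        primitive_idem orthogonal_idem sum_idem)
qed

end
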